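(* Every regular $L$-operator is a closed and densely defined operator on $\ell^2(\mathbb{N}_0)$.
   Context: $\mathbb{N}_0=\{0,1,2,\dots\}$. An $L$-matrix with parameter sequence $a=\{a_n\}_{n=0}^\infty$ (a complex sequence) is the semi-infinite matrix $\mathcal{L}$ with $\mathcal{L}_{m,n}=a_{\max(m,n)}$, $m,n\in\mathbb{N}_0$. It is regular if $a_n\ne a_{n+1}$ for all $n\in\mathbb{N}_0$. For regular $\mathcal{L}$ put $b_n=\frac{1}{a_n-a_{n+1}}$ and let $\mathcal{J}$ be the tridiagonal matrix with $\mathcal{J}_{0,0}=b_0$, $\mathcal{J}_{n,n}=b_{n-1}+b_n$ for $n\ge1$, $\mathcal{J}_{n,n+1}=\mathcal{J}_{n+1,n}=-b_n$ for $n\ge0$, and other entries $0$. Let $J$ be the operator on $\ell^2(\mathbb{N}_0)$ determined by $\mathcal{J}$: $Jx=\mathcal{J}\cdot x$ with $\mathrm{Dom}\,J=\{x\in\ell^2(\mathbb{N}_0):\mathcal{J}\cdot x\in\ell^2(\mathbb{N}_0)\}$; it coincides with the closure of its restriction to finitely supported sequences, and it is injective. The regular $L$-operator associated to the regular $L$-matrix $\mathcal{L}$ is $L:=J^{-1}$, with $\mathrm{Dom}\,L=\mathrm{Ran}\,J$. The parameter sequence $a$ is not assumed to be square summable. *)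

theory Defs
  imports "HOL-Analysis.Analysis"
begin

section \<open>The Hilbert space of square summable complex sequences\<close>

lemma summable_mult_of_summable_squares:
  fixes x y :: "nat \<Rightarrow> complex"
  assumes "summable (\<lambda>n. (cmod (x n))\<^sup>2)" "summable (\<lambda>n. (cmod (y n))\<^sup>2)"
  shows "summable (\<lambda>n. cmod (x n) * cmod (y n))"
proof (rule summable_comparison_test')
  show "summable (\<lambda>n. (cmod (x n))\<^sup>2 + (cmod (y n))\<^sup>2)"
    using assms by (rule summable_add)
  fix n
  have "2 * (cmod (x n) * cmod (y n)) \<le> (cmod (x n))\<^sup>2 + (cmod (y n))\<^sup>2"
    using sum_squares_bound[of "cmod (x n)" "cmod (y n)"] by simp
  moreover have "0 \<le> cmod (x n) * cmod (y n)" by simp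
  ultimately show "norm (cmod (x n) * cmod (y n)) \<le> (cmod (x n))\<^sup>2 + (cmod (y n))\<^sup>2"
    unfolding real_norm_def abs_of_nonneg[OF \<open>0 \<le> cmod (x n) * cmod (y n)\<close>]
    by linarith
qed

lemma square_summable_add:
  fixes x y :: "nat \<Rightarrow> complex"
  assumes "summable (\<lambda>n. (cmod (x n))\<^sup>2)" "summable (\<lambda>n. (cmod (y n))\<^sup>2)"
  shows "summable (\<lambda>n. (cmod (x n + y n))\<^sup>2)"
proof (rule summable_comparison_test')
  show "summable (\<lambda>n. (cmod (x n))\<^sup>2 + 2 * (cmod (x n) * cmod (y n)) + (cmod (y n))\<^sup>2)"
    by (intro summable_add summable_mult summable_mult_of_summable_squares assms)
  fix n
  have "(cmod (x n + y n))\<^sup>2 \<le> (cmod (x n) + cmod (y n))\<^sup>2"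
    by (intro power_mono norm_triangle_ineq norm_ge_zero)
  then show "norm ((cmod (x n + y n))\<^sup>2)
      \<le> (cmod (x n))\<^sup>2 + 2 * (cmod (x n) * cmod (y n)) + (cmod (y n))\<^sup>2"
    by (simp add: power2_sum algebra_simps)
qed

lemma square_summable_scale:
  fixes x :: "nat \<Rightarrow> complex"
  assumes "summable (\<lambda>n. (cmod (x n))\<^sup>2)"
  shows "summable (\<lambda>n. (cmod (c * x n))\<^sup>2)"
  using summable_mult[OF assms, of "(cmod c)\<^sup>2"] by (simp add: norm_mult power_mult_distrib)

typedef ell2 = "{x :: nat \<Rightarrow> complex. summable (\<lambda>n. (cmod (x n))\<^sup>2)}"
  morphisms ell2_nth Abs_ell2
  by (rule exI[of _ "\<lambda>_. 0"]) simp

setup_lifting type_definition_ell2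

lift_definition scaleC_ell2 :: "complex \<Rightarrow> ell2 \<Rightarrow> ell2" is "\<lambda>c x n. c * x n"
  by (rule square_summable_scale)

text \<open>
  The class \<^class>\<open>real_inner\<close> provides the norm and the topology.  Its inner product is
  the real part of the usual Hermitian inner product, since
  \<^term>\<open>inner z w = Re (z * cnj w)\<close> for complex numbers; the complex scalar
  multiplication is \<^const>\<open>scaleC_ell2\<close>.
\<close>

instantiation ell2 :: real_inner
begin

lift_definition zero_ell2 :: ell2 is "\<lambda>_. 0" by simp

lift_definition plus_ell2 :: "ell2 \<Rightarrow> ell2 \<Rightarrow> ell2" is "\<lambda>x y n. x n + y n"
  by (rule square_summable_add)

lift_definition uminus_ell2 :: "ell2 \<Rightarrow> ell2" is "\<lambda>x n. - x n" by simp

definition minus_ell2 :: "ell2 \<Rightarrow> ell2 \<Rightarrow> ell2" where "minus_ell2 x y = x + - y"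

definition scaleR_ell2 :: "real \<Rightarrow> ell2 \<Rightarrow> ell2" where
  "scaleR_ell2 r = scaleC_ell2 (complex_of_real r)"

definition inner_ell2 :: "ell2 \<Rightarrow> ell2 \<Rightarrow> real" where
  "inner_ell2 x y = (\<Sum>n. inner (ell2_nth x n) (ell2_nth y n))"

definition norm_ell2 :: "ell2 \<Rightarrow> real" where
  "norm_ell2 x = sqrt (\<Sum>n. (cmod (ell2_nth x n))\<^sup>2)"

definition sgn_ell2 :: "ell2 \<Rightarrow> ell2" where "sgn_ell2 x = inverse (norm x) *\<^sub>R x"

definition dist_ell2 :: "ell2 \<Rightarrow> ell2 \<Rightarrow> real" where "dist_ell2 x y = norm (x - y)"

definition uniformity_ell2 :: "(ell2 \<times> ell2) filter" where
  "uniformity_ell2 = (INF e\<in>{0 <..}. principal {(x, y). dist x y < e})"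

definition open_ell2 :: "ell2 set \<Rightarrow> bool" where
  "open_ell2 U \<longleftrightarrow> (\<forall>x\<in>U. \<forall>\<^sub>F (x', y) in uniformity. x' = x \<longrightarrow> y \<in> U)"

instance
proof
  fix x y z :: ell2 and r s :: real
  show "x + y + z = x + (y + z)" by transfer (simp add: add.assoc)
  show "x + y = y + x" by transfer (simp add: add.commute)
  show "0 + x = x" by transfer simp
  show "- x + x = 0" by transfer simp
  show "x - y = x + - y" by (rule minus_ell2_def)
  show "r *\<^sub>R (x + y) = r *\<^sub>R x + r *\<^sub>R y"
    unfolding scaleR_ell2_def by transfer (simp add: distrib_left)
  show "(r + s) *\<^sub>R x = r *\<^sub>R x + s *\<^sub>R x"
    unfolding scaleR_ell2_def by transfer (simp add: distrib_right)
  show "r *\<^sub>R s *\<^sub>R x = (r * s) *\<^sub>R x"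
    unfolding scaleR_ell2_def by transfer (simp add: mult.assoc)
  show "1 *\<^sub>R x = x" unfolding scaleR_ell2_def by transfer simp
  show "sgn x = inverse (norm x) *\<^sub>R x" by (rule sgn_ell2_def)
  show "dist x y = norm (x - y)" by (rule dist_ell2_def)
  show "(uniformity :: (ell2 \<times> ell2) filter)
      = (INF e\<in>{0 <..}. principal {(x, y). dist x y < e})"
    by (rule uniformity_ell2_def)
  show "open U \<longleftrightarrow> (\<forall>x\<in>U. \<forall>\<^sub>F (x', y) in uniformity. x' = x \<longrightarrow> y \<in> U)"
    for U :: "ell2 set"
    by (rule open_ell2_def)
  have sq: "summable (\<lambda>n. (cmod (ell2_nth u n))\<^sup>2)" for u
    using ell2_nth[of u] by simp
  have ip: "summable (\<lambda>n. inner (ell2_nth u n) (ell2_nth v n))" for u v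
    by (rule summable_comparison_test'[OF summable_mult_of_summable_squares[OF sq[of u] sq[of v]]])
      (simp add: Cauchy_Schwarz_ineq2)
  have self: "inner u u = (\<Sum>n. (cmod (ell2_nth u n))\<^sup>2)" for u :: ell2
    by (simp add: inner_ell2_def power2_norm_eq_inner)
  show "inner x y = inner y x" by (simp add: inner_ell2_def inner_commute)
  show "inner (x + y) z = inner x z + inner y z"
    unfolding inner_ell2_def plus_ell2.rep_eq inner_add_left
    by (rule suminf_add[OF ip ip, symmetric])
  have "inner (complex_of_real r * u) v = r * inner u v" for u v
    by (simp add: inner_complex_def algebra_simps)
  then show "inner (r *\<^sub>R x) y = r * inner x y"
    unfolding inner_ell2_def scaleR_ell2_def scaleC_ell2.rep_eq
    by (simp add: suminf_mult[OF ip])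
  show "0 \<le> inner x x" unfolding self by (rule suminf_nonneg[OF sq]) simp
  show "inner x x = 0 \<longleftrightarrow> x = 0"
    unfolding self suminf_eq_zero_iff[OF sq zero_le_power2]
    by (auto simp: ell2_nth_inject[symmetric] zero_ell2.rep_eq fun_eq_iff)
  show "norm x = sqrt (inner x x)" unfolding self by (rule norm_ell2_def)
qed

end

section \<open>Unbounded operators\<close>

text \<open>
  A linear operator in the Hilbert space, with a domain that need not be the whole space, is
  identified with its graph.  The domain, the range and the inverse of an injective operator
  are then \<^const>\<open>Domain\<close>, \<^const>\<open>Range\<close> and \<^const>\<open>converse\<close>.
\<close>

definition linear_operator :: "(ell2 \<times> ell2) set \<Rightarrow> bool" where
  "linear_operator T \<longleftrightarrow> single_valued T \<and> (0, 0) \<in> T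
    \<and> (\<forall>x y x' y'. (x, y) \<in> T \<longrightarrow> (x', y') \<in> T \<longrightarrow> (x + x', y + y') \<in> T)
    \<and> (\<forall>c x y. (x, y) \<in> T \<longrightarrow> (scaleC_ell2 c x, scaleC_ell2 c y) \<in> T)"

definition closed_operator :: "(ell2 \<times> ell2) set \<Rightarrow> bool" where
  "closed_operator T \<longleftrightarrow> linear_operator T \<and> closed T"

definition densely_defined :: "(ell2 \<times> ell2) set \<Rightarrow> bool" where
  "densely_defined T \<longleftrightarrow> closure (Domain T) = UNIV"

section \<open>L-matrices and L-operators\<close>

type_synonym cmatrix = "nat \<Rightarrow> nat \<Rightarrow> complex"

definition L_matrix :: "(nat \<Rightarrow> complex) \<Rightarrow> cmatrix" where
  "L_matrix a = (\<lambda>m n. a (max m n))"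

definition regular_L_matrix :: "cmatrix \<Rightarrow> bool" where
  "regular_L_matrix M \<longleftrightarrow> (\<exists>a. M = L_matrix a \<and> (\<forall>n. a n \<noteq> a (Suc n)))"

text \<open>The parameter sequence of an L-matrix is its diagonal.\<close>

definition L_param :: "cmatrix \<Rightarrow> nat \<Rightarrow> complex" where
  "L_param M n = M n n"

lemma L_param_L_matrix [simp]: "L_param (L_matrix a) = a"
  by (simp add: L_param_def L_matrix_def fun_eq_iff)

definition jacobi_coeff :: "(nat \<Rightarrow> complex) \<Rightarrow> nat \<Rightarrow> complex" where
  "jacobi_coeff a n = 1 / (a n - a (Suc n))"

definition jacobi_matrix :: "(nat \<Rightarrow> complex) \<Rightarrow> cmatrix" where
  "jacobi_matrix b m n =
    (if m = n then (if n = 0 then b 0 else b (n - 1) + b n)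
     else if n = Suc m then - b m
     else if m = Suc n then - b n
     else 0)"

text \<open>
  The matrices to which this is applied have finitely many nonzero entries in each row, so
  the series are finite sums.
\<close>

definition mat_apply :: "cmatrix \<Rightarrow> (nat \<Rightarrow> complex) \<Rightarrow> nat \<Rightarrow> complex" where
  "mat_apply A x m = (\<Sum>n. A m n * x n)"

text \<open>
  The operator with domain \<open>{x \<in> \<ell>\<^sup>2. A x \<in> \<ell>\<^sup>2}\<close>: since \<open>y\<close> ranges over \<^typ>\<open>ell2\<close>, the
  sequence \<open>x\<close> is in the domain iff \<open>A x\<close> is square summable.
\<close>

definition mat_operator :: "cmatrix \<Rightarrow> (ell2 \<times> ell2) set" where
  "mat_operator A = {(x, y). ell2_nth y = mat_apply A (ell2_nth x)}"

definition L_operator :: "cmatrix \<Rightarrow> (ell2 \<times> ell2) set" where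
  "L_operator M = (mat_operator (jacobi_matrix (jacobi_coeff (L_param M))))\<inverse>"

end

theory Submission
  imports Defs
begin

text \<open>
  Summing the equations of \<open>J y = x\<close> telescopes to
  \<open>b n * (y n - y (Suc n)) = (\<Sum>k\<le>n. x k)\<close>.  Hence the kernel of the formal Jacobi matrix
  consists of constant sequences, which makes \<open>J\<close> injective on \<open>\<ell>\<^sup>2\<close>, and every finitely
  supported \<open>x\<close> with zero sum is of the form \<open>J y\<close> with \<open>y\<close> finitely supported.  Such
  sequences are dense in \<open>\<ell>\<^sup>2\<close>: an excess \<open>s\<close> of the sum can be cancelled by \<open>K\<close> further
  entries \<open>- s / K\<close>, whose total norm is \<open>cmod s / sqrt K\<close>.
\<close>

section \<open>Coordinates, norm and truncations in \<open>ell2\<close>\<close>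

lemma summable_ell2_nth: "summable (\<lambda>n. (cmod (ell2_nth x n))\<^sup>2)"
  using ell2_nth[of x] by simp

lemma norm_ell2_squared: "(norm x)\<^sup>2 = (\<Sum>n. (cmod (ell2_nth x n))\<^sup>2)"
  unfolding norm_ell2_def
  by (simp add: suminf_nonneg summable_ell2_nth)

lemma cmod_ell2_nth_le: "cmod (ell2_nth x n) \<le> norm x"
proof (rule power2_le_imp_le)
  show "(cmod (ell2_nth x n))\<^sup>2 \<le> (norm x)\<^sup>2"
    unfolding norm_ell2_squared
    using sum_le_suminf[OF summable_ell2_nth, of "{n}" x] by simp
qed simp

lemma ell2_nth_minus: "ell2_nth (x - y) n = ell2_nth x n - ell2_nth y n"
  unfolding minus_ell2_def plus_ell2.rep_eq uminus_ell2.rep_eq by simp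

text \<open>Continuity of the coordinates is what later makes the graph of a matrix operator
  closed.\<close>

lemma bounded_linear_ell2_nth: "bounded_linear (\<lambda>x. ell2_nth x n)"
proof (rule bounded_linear_intro[where K = 1])
  show "ell2_nth (x + y) n = ell2_nth x n + ell2_nth y n" for x y
    by (simp add: plus_ell2.rep_eq)
  show "ell2_nth (r *\<^sub>R x) n = r *\<^sub>R ell2_nth x n" for r x
    by (simp add: scaleR_ell2_def scaleC_ell2.rep_eq scaleR_conv_of_real)
  show "norm (ell2_nth x n) \<le> norm x * 1" for x
    by (simp add: cmod_ell2_nth_le)
qed

lemma ell2_finite_support:
  assumes "\<And>n. n \<ge> N \<Longrightarrow> x n = 0"
  obtains u where "ell2_nth u = x"
proof -
  have "summable (\<lambda>n. (cmod (x n))\<^sup>2)"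
    by (rule summable_finite[of "{..<N}"]) (auto simp: assms)
  then have "ell2_nth (Abs_ell2 x) = x"
    by (simp add: Abs_ell2_inverse)
  then show thesis
    by (rule that)
qed

text \<open>The terms of the convergent series of squares tend to 0, and a constant sequence equals
  its limit.\<close>

lemma ell2_constant_eq_0:
  assumes "\<And>n. ell2_nth x (Suc n) = ell2_nth x n"
  shows "x = 0"
proof -
  have const: "ell2_nth x n = ell2_nth x 0" for n
    by (induction n) (simp_all add: assms)
  have "(\<lambda>n. (cmod (ell2_nth x n))\<^sup>2) \<longlonglongrightarrow> 0"
    by (rule summable_LIMSEQ_zero) (rule summable_ell2_nth)
  also have "(\<lambda>n. (cmod (ell2_nth x n))\<^sup>2) = (\<lambda>n. (cmod (ell2_nth x 0))\<^sup>2)"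
    by (rule ext) (rule arg_cong[OF const])
  finally have "(\<lambda>n::nat. (cmod (ell2_nth x 0))\<^sup>2) \<longlonglongrightarrow> 0" .
  then have "ell2_nth x 0 = 0"
    by (simp add: LIMSEQ_const_iff)
  then have "ell2_nth x n = ell2_nth 0 n" for n
    using const[of n] by (simp add: zero_ell2.rep_eq)
  then show ?thesis
    by (simp add: ell2_nth_inject[symmetric] fun_eq_iff)
qed

lemma ell2_truncation_tendsto:
  assumes "\<And>N n. ell2_nth (t N) n = (if n < N then ell2_nth x n else 0)"
  shows "t \<longlonglongrightarrow> x"
proof -
  have "(norm (t N - x))\<^sup>2 = (\<Sum>n. (cmod (ell2_nth x (n + N)))\<^sup>2)" for N
  proof -
    \<comment> \<open>\<open>t N\<close> agrees with \<open>x\<close> below \<open>N\<close>, so the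
      squared error is a tail of a convergent series.\<close>
    have "(norm (t N - x))\<^sup>2 = (\<Sum>n. (cmod (ell2_nth (t N - x) (n + N)))\<^sup>2)"
      unfolding norm_ell2_squared
      by (subst suminf_split_initial_segment[OF summable_ell2_nth, of _ N])
        (simp add: ell2_nth_minus assms)
    also have "\<dots> = (\<Sum>n. (cmod (ell2_nth x (n + N)))\<^sup>2)"
      by (simp add: ell2_nth_minus assms)
    finally show ?thesis .
  qed
  then have "(\<lambda>N. (norm (t N - x))\<^sup>2) \<longlonglongrightarrow> 0"
    using suminf_exist_split2[OF summable_ell2_nth[of x]] by simp
  then have "(\<lambda>N. sqrt ((norm (t N - x))\<^sup>2)) \<longlonglongrightarrow> sqrt 0"
    by (rule tendsto_real_sqrt)
  then show ?thesis
    by (simp add: LIM_zero_iff tendsto_norm_zero_iff)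
qed

section \<open>Density of the finitely supported sequences with zero sum\<close>

lemma zero_sum_in_closure:
  fixes x :: ell2
  defines "Z \<equiv> {u. \<exists>N. (\<forall>n\<ge>N. ell2_nth u n = 0) \<and> (\<Sum>n<N. ell2_nth u n) = 0}"
  assumes supp: "\<And>n. n \<ge> N \<Longrightarrow> ell2_nth x n = 0"
  shows "x \<in> closure Z"
proof -
  define s where "s = (\<Sum>n<N. ell2_nth x n)"
  \<comment> \<open>The correction \<open>v K\<close> places \<open>Suc K\<close> copies of
    \<open>c K\<close> just beyond the support of \<open>x\<close>. Its sum is \<open>s\<close>, and
    using \<open>Suc K\<close> keeps the divisor nonzero at \<open>K = 0\<close>.\<close>
  define c where "c K = s / of_nat (Suc K)" for K
  have "\<exists>v. ell2_nth v = (\<lambda>n. if N \<le> n \<and> n < N + Suc K then c K else 0)" for K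
    by (rule ell2_finite_support[of "N + Suc K"
          "\<lambda>n. if N \<le> n \<and> n < N + Suc K then c K else 0"]) auto
  then obtain v
    where v: "\<And>K. ell2_nth (v K) = (\<lambda>n. if N \<le> n \<and> n < N + Suc K then c K else 0)"
    by metis
  have "x - v K \<in> Z" for K
  proof -
    have "(\<Sum>n<N + Suc K. ell2_nth (x - v K) n)
        = (\<Sum>n<N. ell2_nth (x - v K) n) + (\<Sum>n\<in>{N..<N + Suc K}. ell2_nth (x - v K) n)"
      by (metis atLeast0LessThan le_add1 sum.atLeastLessThan_concat zero_le)
    also have "(\<Sum>n<N. ell2_nth (x - v K) n) = s"
      unfolding s_def by (rule sum.cong) (auto simp: ell2_nth_minus v)
    also have "(\<Sum>n\<in>{N..<N + Suc K}. ell2_nth (x - v K) n)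
        = (\<Sum>n\<in>{N..<N + Suc K}. - c K)"
      by (rule sum.cong) (auto simp: ell2_nth_minus v supp)
    also have "\<dots> = - s"
      unfolding c_def by (simp del: of_nat_Suc)
    finally have "(\<Sum>n<N + Suc K. ell2_nth (x - v K) n) = 0"
      by simp
    moreover have "\<forall>n\<ge>N + Suc K. ell2_nth (x - v K) n = 0"
      by (auto simp: ell2_nth_minus v supp)
    ultimately show ?thesis
      unfolding Z_def by blast
  qed
  moreover have "(\<lambda>K. x - v K) \<longlonglongrightarrow> x - 0"
  proof (intro tendsto_intros)
    \<comment> \<open>There are \<open>K + 1\<close> entries of squared modulus
      \<open>(cmod s)^2 / (K + 1)^2\<close>: spreading the correction out keeps its sum but makes
      its norm vanish.\<close>
    have "(norm (v K))\<^sup>2 = (cmod s)\<^sup>2 * inverse (real (Suc K))" for K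
    proof -
      have "(norm (v K))\<^sup>2 = (\<Sum>n\<in>{N..<N + Suc K}. (cmod (ell2_nth (v K) n))\<^sup>2)"
        unfolding norm_ell2_squared by (rule suminf_finite) (auto simp: v)
      also have "\<dots> = (\<Sum>n\<in>{N..<N + Suc K}. (cmod (c K))\<^sup>2)"
        by (rule sum.cong) (auto simp: v)
      also have "\<dots> = (cmod s)\<^sup>2 * inverse (real (Suc K))"
        unfolding c_def norm_divide norm_of_nat
        by (simp add: power2_eq_square field_simps del: of_nat_Suc)
      finally show ?thesis .
    qed
    then have "(\<lambda>K. (norm (v K))\<^sup>2) \<longlonglongrightarrow> 0"
      using tendsto_mult_right_zero[OF LIMSEQ_inverse_real_of_nat] by simp
    then have "(\<lambda>K. sqrt ((norm (v K))\<^sup>2)) \<longlonglongrightarrow> sqrt 0"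
      by (rule tendsto_real_sqrt)
    then show "v \<longlonglongrightarrow> 0"
      by (simp add: tendsto_norm_zero_iff)
  qed
  ultimately show ?thesis
    unfolding closure_sequential diff_zero
    by (intro exI[of _ "\<lambda>K. x - v K"] conjI allI)
qed

lemma zero_sum_dense:
  "closure {u. \<exists>N. (\<forall>n\<ge>N. ell2_nth u n = 0) \<and> (\<Sum>n<N. ell2_nth u n) = 0} = UNIV"
  (is "closure ?Z = UNIV")
proof -
  have "x \<in> closure ?Z" for x
  proof -
    have "\<exists>u. ell2_nth u = (\<lambda>n. if n < N then ell2_nth x n else 0)" for N
      by (rule ell2_finite_support[of N "\<lambda>n. if n < N then ell2_nth x n else 0"]) auto
    then obtain t where t: "\<And>N. ell2_nth (t N) = (\<lambda>n. if n < N then ell2_nth x n else 0)"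
      by metis
    have "t N \<in> closure ?Z" for N
      by (rule zero_sum_in_closure[of N]) (simp add: t)
    moreover have "t \<longlonglongrightarrow> x"
      by (rule ell2_truncation_tendsto) (simp add: t)
    \<comment> \<open>The closure already contains all limits, so approximating the truncations
      suffices and no diagonal sequence has to be chosen.\<close>
    ultimately show ?thesis
      using closed_sequentially[OF closed_closure] by blast
  qed
  then show ?thesis
    by blast
qed

section \<open>Operators of matrices with finite rows\<close>

lemma mat_apply_finite_rows:
  assumes "finite {n. A m n \<noteq> 0}"
  shows "mat_apply A x m = (\<Sum>n | A m n \<noteq> 0. A m n * x n)"
  unfolding mat_apply_def by (rule suminf_finite[OF assms]) simp

text \<open>Each row gives one equation between finitely many continuous coordinates, hence a closed
  set of pairs; the graph is the intersection over all rows. In the converse, \<open>fst p\<close>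
  is the image and \<open>snd p\<close> the argument.\<close>

lemma closed_converse_mat_operator:
  assumes "\<And>m. finite {n. A m n \<noteq> 0}"
  shows "closed ((mat_operator A)\<inverse>)"
proof -
  have "(mat_operator A)\<inverse>
      = (\<Inter>m. {p. ell2_nth (fst p) m = (\<Sum>n | A m n \<noteq> 0. A m n * ell2_nth (snd p) n)})"
    by (auto simp: mat_operator_def fun_eq_iff mat_apply_finite_rows[OF assms])
  also have "closed \<dots>"
    by (intro closed_INT ballI closed_Collect_eq continuous_intros
        bounded_linear.continuous_on[OF bounded_linear_ell2_nth])
  finally show ?thesis .
qed

text \<open>Single-valuedness of the converse is injectivity of the operator. A trivial kernel
  yields it because finite rows make \<open>mat_apply\<close> additive, so the difference of two
  preimages lies in the kernel.\<close>

lemma linear_operator_converse_mat_operator: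
  assumes fin: "\<And>m. finite {n. A m n \<noteq> 0}"
    and inj: "\<And>x. mat_apply A (ell2_nth x) = (\<lambda>_. 0) \<Longrightarrow> x = 0"
  shows "linear_operator ((mat_operator A)\<inverse>)"
proof -
  have zero: "mat_apply A (\<lambda>_. 0) m = 0" for m
    by (simp add: mat_apply_finite_rows[OF fin])
  have add: "mat_apply A (\<lambda>n. x n + x' n) m = mat_apply A x m + mat_apply A x' m" for x x' m
    by (simp add: mat_apply_finite_rows[OF fin] distrib_left sum.distrib)
  have scale: "mat_apply A (\<lambda>n. c * x n) m = c * mat_apply A x m" for c x m
    by (simp add: mat_apply_finite_rows[OF fin] sum_distrib_left mult.left_commute)
  have diff: "mat_apply A (ell2_nth (x - x')) m
      = mat_apply A (ell2_nth x) m - mat_apply A (ell2_nth x') m" for x x' m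
    by (simp add: mat_apply_finite_rows[OF fin] ell2_nth_minus right_diff_distrib
        sum_subtractf)
  have "single_valued ((mat_operator A)\<inverse>)"
  proof (rule single_valuedI)
    fix y x x'
    assume "(y, x) \<in> (mat_operator A)\<inverse>" "(y, x') \<in> (mat_operator A)\<inverse>"
    then have "mat_apply A (ell2_nth (x - x')) = (\<lambda>_. 0)"
      by (simp add: mat_operator_def fun_eq_iff diff)
    then show "x = x'"
      using inj[of "x - x'"] by simp
  qed
  then show ?thesis
    unfolding linear_operator_def mat_operator_def
    by (auto simp: fun_eq_iff zero add scale plus_ell2.rep_eq scaleC_ell2.rep_eq zero_ell2.rep_eq)
qed

section \<open>The Jacobi matrix and the L-operator\<close>

lemma finite_jacobi_matrix_row: "finite {n. jacobi_matrix b m n \<noteq> 0}"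
  by (rule finite_subset[of _ "{..Suc m}"]) (auto simp: jacobi_matrix_def split: if_splits)

lemma mat_apply_jacobi_matrix_0:
  "mat_apply (jacobi_matrix b) x 0 = b 0 * (x 0 - x 1)"
proof -
  have "mat_apply (jacobi_matrix b) x 0 = (\<Sum>n\<in>{0, 1}. jacobi_matrix b 0 n * x n)"
    unfolding mat_apply_def by (rule suminf_finite) (auto simp: jacobi_matrix_def)
  then show ?thesis
    by (simp add: jacobi_matrix_def algebra_simps)
qed

lemma mat_apply_jacobi_matrix_Suc:
  "mat_apply (jacobi_matrix b) x (Suc m)
    = b (Suc m) * (x (Suc m) - x (Suc (Suc m))) - b m * (x m - x (Suc m))"
proof -
  have "mat_apply (jacobi_matrix b) x (Suc m)
      = (\<Sum>n\<in>{m, Suc m, Suc (Suc m)}. jacobi_matrix b (Suc m) n * x n)"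
    unfolding mat_apply_def by (rule suminf_finite) (auto simp: jacobi_matrix_def)
  then show ?thesis
    by (simp add: jacobi_matrix_def algebra_simps)
qed

text \<open>Forwards, the rows telescope by induction; backwards, row \<open>Suc m\<close> is the
  difference of the identities at \<open>Suc m\<close> and \<open>m\<close>, and row 0 is the
  identity at 0.\<close>

lemma mat_apply_jacobi_matrix_eq_iff:
  "mat_apply (jacobi_matrix b) y = x
    \<longleftrightarrow> (\<forall>n. b n * (y n - y (Suc n)) = (\<Sum>k\<le>n. x k))"
proof
  assume "mat_apply (jacobi_matrix b) y = x"
  then have x: "x n = mat_apply (jacobi_matrix b) y n" for n
    by simp
  have "(\<Sum>k\<le>n. x k) = b n * (y n - y (Suc n))" for n
    by (induction n) (simp_all add: x mat_apply_jacobi_matrix_0 mat_apply_jacobi_matrix_Suc)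
  then show "\<forall>n. b n * (y n - y (Suc n)) = (\<Sum>k\<le>n. x k)"
    by simp
next
  assume *: "\<forall>n. b n * (y n - y (Suc n)) = (\<Sum>k\<le>n. x k)"
  have "mat_apply (jacobi_matrix b) y n = x n" for n
  proof (cases n)
    case 0
    then show ?thesis
      using *[rule_format, of 0] by (simp add: mat_apply_jacobi_matrix_0)
  next
    case (Suc m)
    then show ?thesis
      by (simp add: mat_apply_jacobi_matrix_Suc *[rule_format])
  qed
  then show "mat_apply (jacobi_matrix b) y = x"
    by blast
qed

lemma jacobi_matrix_kernel:
  assumes "\<And>n. b n \<noteq> 0" "mat_apply (jacobi_matrix b) (ell2_nth x) = (\<lambda>_. 0)"
  shows "x = 0"
proof (rule ell2_constant_eq_0)
  show "ell2_nth x (Suc n) = ell2_nth x n" for n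
    using assms(2) assms(1)[of n] unfolding mat_apply_jacobi_matrix_eq_iff
    by (metis eq_iff_diff_eq_0 mult_eq_0_iff sum.neutral_const)
qed

lemma zero_sum_in_range_jacobi:
  assumes b: "\<And>n. b n \<noteq> 0"
    and supp: "\<And>n. n \<ge> N \<Longrightarrow> ell2_nth x n = 0"
    and sum: "(\<Sum>n<N. ell2_nth x n) = 0"
  shows "x \<in> Range (mat_operator (jacobi_matrix b))"
proof -
  \<comment> \<open>The partial sum identity forces \<open>d n\<close> to be the difference of
    \<open>y\<close> at \<open>n\<close> and \<open>Suc n\<close>. As the total sum is zero,
    \<open>d\<close> vanishes from \<open>N\<close> on.\<close>
  define d where "d n = (\<Sum>k\<le>n. ell2_nth x k) / b n" for n
  have d_0: "d n = 0" if "n \<ge> N" for n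
  proof -
    have "(\<Sum>k\<le>n. ell2_nth x k) = (\<Sum>k<N. ell2_nth x k)"
      by (rule sum.mono_neutral_right) (use that supp in auto)
    then show ?thesis
      by (simp add: d_def sum)
  qed
  \<comment> \<open>Summing the differences back from the value 0 at \<open>N\<close> gives a
    finitely supported solution, which therefore lies in \<open>ell2\<close>.\<close>
  obtain y where y: "ell2_nth y = (\<lambda>n. \<Sum>k\<in>{n..<N}. d k)"
    by (rule ell2_finite_support[of N "\<lambda>n. \<Sum>k\<in>{n..<N}. d k"]) auto
  have "ell2_nth y n - ell2_nth y (Suc n) = d n" for n
    \<comment> \<open>For \<open>n\<close> at least \<open>N\<close> both sums are empty and
      \<open>d_0\<close> applies.\<close>
    by (cases "n < N") (simp_all add: y d_0 sum.atLeast_Suc_lessThan)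
  then have "mat_apply (jacobi_matrix b) (ell2_nth y) = ell2_nth x"
    unfolding mat_apply_jacobi_matrix_eq_iff by (simp add: d_def b)
  then have "(y, x) \<in> mat_operator (jacobi_matrix b)"
    by (simp add: mat_operator_def)
  then show ?thesis ..
qed

theorem proposition7:
  fixes M :: cmatrix
  assumes "regular_L_matrix M"
  shows "closed_operator (L_operator M) \<and> densely_defined (L_operator M)"
proof -
  define b where "b = jacobi_coeff (L_param M)"
  have L: "L_operator M = (mat_operator (jacobi_matrix b))\<inverse>"
    by (simp add: L_operator_def b_def)
  have b: "b n \<noteq> 0" for n
    using assms by (auto simp: b_def regular_L_matrix_def jacobi_coeff_def)
  have "closed_operator (L_operator M)"
    unfolding closed_operator_def L
    by (intro conjI linear_operator_converse_mat_operator closed_converse_mat_operator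
        finite_jacobi_matrix_row jacobi_matrix_kernel[of b] b)
  \<comment> \<open>The domain of the inverse is the range of the Jacobi operator, which contains a
    dense set.\<close>
  moreover have "{u. \<exists>N. (\<forall>n\<ge>N. ell2_nth u n = 0) \<and> (\<Sum>n<N. ell2_nth u n) = 0}
      \<subseteq> Domain (L_operator M)"
    unfolding L Domain_converse using zero_sum_in_range_jacobi[of b, OF b] by blast
  then have "densely_defined (L_operator M)"
    unfolding densely_defined_def using closure_mono zero_sum_dense by blast
  ultimately show ?thesis ..
qed

end
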